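(* Let $t,\delta$ be positive real numbers. Suppose there exists a real number $\epsilon$ with $0<\epsilon<1/2$ such that, with $\lambda=\sqrt{1-2\epsilon}$, all of the following hold: $$\frac{(1+\delta-\epsilon\delta)t}{2}<\frac{4}{3}(1+\delta)\left(t(1+\delta)-\frac{1}{4}\right);$$ $$\frac{8}{3t}\left(t(1+\delta)-\frac{1}{4}\right)(1+\delta)+\frac{t}{12}(\lambda+1)\left(4(1-\epsilon)-(1-\lambda)^2\right)>1+\delta;$$ $$\frac{16}{3}(1+\delta)>\frac{2}{3t}+1.$$ Then every simple edge-colored graph $G$ on $n$ vertices with at least $(1+\delta)n$ color classes, each of size at least $tn$, contains a rainbow triangle.
   Context: An edge-coloring of a graph $G$ is an arbitrary map $f:E(G)\to\mathbb{N}$ (not necessarily proper); for a color $i$, the set $f^{-1}(i)$ is the color class of $i$, and its size is its number of edges. A rainbow triangle is a triangle in $G$ whose three edges have pairwise distinct colors. A graph is simple if it has no loops or parallel edges. *)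

theory Defs
  imports Complex_Main "HOL-Library.Ramsey"
begin

text \<open>
  An edge is a two-element set of vertices, so loops and parallel edges are excluded.
  Following the usual convention, a graph has a nonempty vertex set.
\<close>

definition simple_graph :: "'a set \<Rightarrow> 'a set set \<Rightarrow> bool" where
  "simple_graph V E \<longleftrightarrow> finite V \<and> V \<noteq> {} \<and> E \<subseteq> nsets V 2"

text \<open>
  An edge-coloring of \<open>E\<close> is the restriction to \<open>E\<close> of a total function on vertex sets;
  its values outside \<open>E\<close> play no role.
\<close>

definition color_class :: "'a set set \<Rightarrow> ('a set \<Rightarrow> nat) \<Rightarrow> nat \<Rightarrow> 'a set set" where
  "color_class E f i = {e \<in> E. f e = i}"

definition has_rainbow_triangle :: "'a set set \<Rightarrow> ('a set \<Rightarrow> nat) \<Rightarrow> bool" where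
  "has_rainbow_triangle E f \<longleftrightarrow>
    (\<exists>x y z. x \<noteq> y \<and> y \<noteq> z \<and> x \<noteq> z \<and>
      {x, y} \<in> E \<and> {y, z} \<in> E \<and> {x, z} \<in> E \<and>
      f {x, y} \<noteq> f {y, z} \<and> f {y, z} \<noteq> f {x, z} \<and> f {x, y} \<noteq> f {x, z})"

end

theory Submission
  imports Defs "HOL-Analysis.Convex"
begin

text \<open>
  Trim each of the \<open>N\<close> large colour classes to \<open>s = \<lceil>t n\<rceil>\<close> edges and let \<open>T\<close> be the number of triangles.
  Without a rainbow triangle every triangle has two edges of one colour, which bounds \<open>T\<close> above by
  \<open>N s (s - 1) / 2\<close>; Goodman's identity \<open>6 T = 2 \<Sum> d(v)\<^sup>2 - 2 m n + p\<close>, with \<open>p\<close> twice the number of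
  triples spanning exactly one edge, bounds it below.

  By the first hypothesis more than \<open>n\<close> colours have at least \<open>(1 - \<epsilon>) s\<^sup>2 / 2\<close> triangles with
  two edges of that colour.
  Such a colour class is close to a star: it has a vertex of degree at least \<open>(1 + \<lambda>) s / 2\<close>, and the
  leaves of that star span almost a clique. By pigeonhole two of these stars have the same centre. An edge
  between their leaf sets \<open>A\<close> and \<open>B\<close> must carry one of the two colours, so there are few such edges,
  and an edge inside \<open>A\<close> with a vertex of \<open>B\<close> (or vice versa) typically spans no further edge. This
  gives \<open>p\<close> a cubic lower bound that contradicts the second hypothesis. The error terms are
  quadratic and are absorbed by the slack between \<open>s\<^sup>2 / 2\<close> and \<open>s (s - 1) / 2\<close> in each colour. The third
  hypothesis makes both inequalities monotone in \<open>N / n\<close>, so rounding does no harm.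
\<close>

section \<open>Triples covered by two edges of one family\<close>

definition star :: "'a set set \<Rightarrow> 'a \<Rightarrow> 'a set set" where
  "star F v = {e \<in> F. v \<in> e}"

text \<open>Vertex sets rather than pairs of edges, so that a triangle with all three edges in
  \<open>F\<close> counts once and the set can be intersected with
  \<open>triangles E\<close>.\<close>

definition wedge_triples :: "'a set set \<Rightarrow> 'a set set" where
  "wedge_triples F = {X. card X = 3 \<and> (\<exists>e\<in>F. \<exists>e'\<in>F. e \<noteq> e' \<and> e \<subseteq> X \<and> e' \<subseteq> X)}"

definition nbhd :: "'a set set \<Rightarrow> 'a \<Rightarrow> 'a set" where
  "nbhd F v = {a. {v, a} \<in> F \<and> a \<noteq> v}"

lemma card_two_subset_union:
  assumes "card X = 3" "e \<subseteq> X" "e' \<subseteq> X" "card e = 2" "card e' = 2" "e \<noteq> e'"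
  shows "e \<union> e' = X"
proof -
  have fX: "finite X" using assms(1) by (simp add: card_ge_0_finite)
  have fe: "finite e" "finite e'" using fX assms finite_subset by auto
  have "\<not> e' \<subseteq> e" using assms fe by (metis card_subset_eq)
  then have "e \<subset> e \<union> e'" by auto
  then have "card e < card (e \<union> e')" using fe by (intro psubset_card_mono) auto
  then have "3 \<le> card (e \<union> e')" using assms by simp
  moreover have "e \<union> e' \<subseteq> X" using assms by auto
  ultimately show ?thesis using fX assms(1) by (metis card_mono card_subset_eq le_antisym)
qed

text \<open>Two distinct edges inside a triple cover it, so pairs of edges determine the triple;
  this yields the bound \<open>card F choose 2\<close>.\<close>

lemma wedge_triples_subset_pairs:
  assumes "\<forall>e\<in>F. card e = 2"
  shows "wedge_triples F \<subseteq> Union ` nsets F 2"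
proof
  fix X assume "X \<in> wedge_triples F"
  then obtain e e' where e: "card X = 3" "e \<in> F" "e' \<in> F" "e \<noteq> e'" "e \<subseteq> X" "e' \<subseteq> X"
    by (auto simp: wedge_triples_def)
  then have "e \<union> e' = X" using card_two_subset_union assms by metis
  then have "X = \<Union>{e, e'}" by auto
  moreover have "{e, e'} \<in> nsets F 2" using e by (auto simp: nsets_def)
  ultimately show "X \<in> Union ` nsets F 2" by blast
qed

lemma finite_wedge_triples:
  assumes "\<forall>e\<in>F. card e = 2" "finite F"
  shows "finite (wedge_triples F)"
  using finite_subset[OF wedge_triples_subset_pairs[OF assms(1)]] assms(2)
  by (simp add: finite_imp_finite_nsets)

lemma card_wedge_triples_le:
  assumes "\<forall>e\<in>F. card e = 2" "finite F"
  shows "card (wedge_triples F) \<le> card F choose 2"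
proof -
  have "card (wedge_triples F) \<le> card (Union ` nsets F 2)"
    using assms by (intro card_mono wedge_triples_subset_pairs) (auto simp: finite_imp_finite_nsets)
  also have "\<dots> \<le> card (nsets F 2)"
    using assms by (intro card_image_le) (auto simp: finite_imp_finite_nsets)
  finally show ?thesis by simp
qed

section \<open>Stars, their leaves, and bounds from removing one star\<close>

lemma star_eq_image:
  assumes "\<forall>e\<in>F. card e = 2"
  shows "star F v = (\<lambda>a. {v, a}) ` nbhd F v"
proof (intro equalityI subsetI)
  fix e assume "e \<in> star F v"
  then have e: "e \<in> F" "v \<in> e" "card e = 2" using assms by (auto simp: star_def)
  then obtain x y where "e = {x, y}" "x \<noteq> y" by (auto simp: card_2_iff)
  with e show "e \<in> (\<lambda>a. {v, a}) ` nbhd F v"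
    by (auto simp: nbhd_def image_iff insert_commute)
qed (auto simp: star_def nbhd_def)

lemma card_nbhd:
  assumes "\<forall>e\<in>F. card e = 2"
  shows "card (nbhd F v) = card (star F v)"
proof -
  have "inj_on (\<lambda>a. {v, a}) (nbhd F v)" by (auto simp: inj_on_def nbhd_def doubleton_eq_iff)
  then show ?thesis using star_eq_image[OF assms] by (simp add: card_image)
qed

lemma finite_nbhd:
  assumes "\<forall>e\<in>F. card e = 2" "finite F"
  shows "finite (nbhd F v)"
proof -
  have "inj_on (\<lambda>a. {v, a}) (nbhd F v)" by (auto simp: inj_on_def nbhd_def doubleton_eq_iff)
  then show ?thesis using star_eq_image[OF assms(1)] assms(2)
    by (metis (no_types, lifting) finite_imageD finite_subset mem_Collect_eq star_def subsetI)
qed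

text \<open>Case split on the role of \<open>v\<close>: both edges meet at \<open>v\<close>, or
  \<open>v\<close> is in the triple but off one edge, which then determines the triple, or
  \<open>v\<close> is outside it. In the first case the pair of leaves is recorded as a pair of
  \<open>X\<close>, so that it is an edge of the graph when \<open>X\<close> is a triangle.\<close>

lemma wedge_triples_cases:
  assumes F: "\<forall>e\<in>F. card e = 2" and X: "X \<in> wedge_triples F"
  shows "X \<in> insert v ` (nsets (nbhd F v) 2 \<inter> nsets X 2) \<or>
         X \<in> insert v ` (F - star F v) \<or> X \<in> wedge_triples (F - star F v)"
proof -
  obtain e e' where e: "card X = 3" "e \<in> F" "e' \<in> F" "e \<noteq> e'" "e \<subseteq> X" "e' \<subseteq> X"
    using X by (auto simp: wedge_triples_def)
  have un: "e \<union> e' = X" using card_two_subset_union e F by metis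
  have one: "insert v g = X" if "g \<in> F" "g \<subseteq> X" "v \<notin> g" "v \<in> X" for g
  proof (rule card_subset_eq)
    show "finite X" using e(1) by (simp add: card_ge_0_finite)
    then have "finite g" using that finite_subset by blast
    then show "card (insert v g) = card X" using that F e(1) by simp
  qed (use that in auto)
  consider "v \<notin> X" | "v \<in> X" "v \<notin> e" | "v \<in> X" "v \<notin> e'" | "v \<in> e" "v \<in> e'" by auto
  then show ?thesis
  proof cases
    case 1
    then have "e \<in> F - star F v" "e' \<in> F - star F v" using e by (auto simp: star_def)
    with e show ?thesis unfolding wedge_triples_def by blast
  next
    case 2
    then have "X = insert v e" "e \<in> F - star F v" using one[of e] e by (auto simp: star_def)
    then show ?thesis by blast
  next
    case 3
    then have "X = insert v e'" "e' \<in> F - star F v" using one[of e'] e by (auto simp: star_def)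
    then show ?thesis by blast
  next
    case 4
    then have "e \<in> star F v" "e' \<in> star F v" using e by (auto simp: star_def)
    then obtain a b where ab: "e = {v, a}" "e' = {v, b}" "a \<in> nbhd F v" "b \<in> nbhd F v"
      unfolding star_eq_image[OF F] by (elim imageE)
    then have "{a, b} \<in> nsets (nbhd F v) 2 \<inter> nsets X 2" "X = insert v {a, b}"
      using e(4) un by (auto simp: nsets_def)
    then show ?thesis by (intro disjI1) (rule image_eqI)
  qed
qed

definition triangles :: "'a set set \<Rightarrow> 'a set set" where
  "triangles E = {X. card X = 3 \<and> nsets X 2 \<subseteq> E}"

text \<open>The sets \<open>H\<close> and \<open>E\<close> are parameters because the count serves
  twice: with \<open>UNIV\<close> for both it gives a recursion for all wedge triples, and with
  \<open>H = triangles E\<close> only edges of the graph between leaves enter the first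
  term.\<close>

lemma card_wedge_triples_Int_le:
  assumes F: "\<forall>e\<in>F. card e = 2" "finite F"
    and H: "\<And>X. X \<in> H \<Longrightarrow> nsets X 2 \<inter> nsets (nbhd F v) 2 \<subseteq> E"
  shows "card (wedge_triples F \<inter> H) \<le>
    card (E \<inter> nsets (nbhd F v) 2) + card (F - star F v) + card (wedge_triples (F - star F v))"
proof -
  let ?A = "insert v ` (E \<inter> nsets (nbhd F v) 2)" and ?B = "insert v ` (F - star F v)"
    and ?C = "wedge_triples (F - star F v)"
  have fin: "finite (E \<inter> nsets (nbhd F v) 2)"
    using finite_nbhd[OF F] by (simp add: finite_imp_finite_nsets)
  have finC: "finite ?C" using F by (intro finite_wedge_triples) auto
  have "wedge_triples F \<inter> H \<subseteq> ?A \<union> ?B \<union> ?C"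
  proof
    fix X assume X: "X \<in> wedge_triples F \<inter> H"
    then have "nsets (nbhd F v) 2 \<inter> nsets X 2 \<subseteq> E \<inter> nsets (nbhd F v) 2" using H[of X] by blast
    then show "X \<in> ?A \<union> ?B \<union> ?C" using wedge_triples_cases[OF F(1), of X v] X
      by (meson IntD1 UnI1 UnI2 image_mono subsetD)
  qed
  then have "card (wedge_triples F \<inter> H) \<le> card (?A \<union> ?B \<union> ?C)"
    using fin finC F(2) by (intro card_mono) auto
  also have "\<dots> \<le> card ?A + card ?B + card ?C"
    by (meson add_le_mono card_Un_le le_trans order_refl)
  also have "\<dots> \<le> card (E \<inter> nsets (nbhd F v) 2) + card (F - star F v) + card ?C"
    using fin F(2) by (intro add_mono card_image_le) auto
  finally show ?thesis .
qed

lemma card_wedge_triples_step: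
  assumes F: "\<forall>e\<in>F. card e = 2" "finite F"
  shows "card (wedge_triples F) \<le>
    (card (star F v) choose 2) + card (F - star F v) + card (wedge_triples (F - star F v))"
  using card_wedge_triples_Int_le[OF F, where H = UNIV and E = UNIV and v = v] card_nbhd[OF F(1)]
  by simp

lemma card_Diff_star:
  assumes "finite F"
  shows "card (F - star F v) + card (star F v) = card F"
proof -
  have "star F v \<subseteq> F" by (auto simp: star_def)
  then show ?thesis using assms by (simp add: card_Diff_subset card_mono finite_subset)
qed

lemma real_choose_two: "real (k choose 2) = real k * (real k - 1) / 2"
proof -
  have "even (k * (k - 1))" by (cases k) auto
  then have "real (k choose 2) = real (k * (k - 1)) / 2"
    unfolding choose_two by (simp add: real_of_nat_div)
  then show ?thesis by (cases k) (auto simp: algebra_simps)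
qed

text \<open>One star is removed and all pairs of remaining edges are counted. For
  \<open>d \<ge> s / 2\<close> the linear part is at most zero, leaving
  \<open>d\<^sup>2 + (s - d)\<^sup>2\<close>.\<close>

lemma card_wedge_triples_star_bound:
  assumes F: "\<forall>e\<in>F. card e = 2" "finite F"
    and d: "d = real (card (star F v))" and s: "s = real (card F)"
  shows "2 * real (card (wedge_triples F)) \<le> d\<^sup>2 + (s - d)\<^sup>2 + s - 2 * d"
proof -
  have q: "real (card (F - star F v)) = s - d" using card_Diff_star[OF F(2), of v] d s by linarith
  have "card (wedge_triples (F - star F v)) \<le> card (F - star F v) choose 2"
    using F by (intro card_wedge_triples_le) auto
  then have "card (wedge_triples F) \<le> (card (star F v) choose 2) + card (F - star F v)
      + (card (F - star F v) choose 2)"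
    using card_wedge_triples_step[OF F, of v] by linarith
  then have "real (card (wedge_triples F)) \<le> real (card (star F v) choose 2) + real (card (F - star F v))
      + real (card (F - star F v) choose 2)" by linarith
  then have "real (card (wedge_triples F)) \<le> d * (d - 1) / 2 + (s - d) + (s - d) * (s - d - 1) / 2"
    unfolding real_choose_two q by (simp add: d)
  also have "\<dots> = (d\<^sup>2 + (s - d)\<^sup>2 + s - 2 * d) / 2" by (simp add: power2_eq_square field_simps)
  finally show ?thesis by simp
qed

text \<open>
  Extremal case: two stars of equal size. Removing a star of maximum degree either preserves the hypothesis
  or leaves a family dominated by another star.
\<close>

lemma card_wedge_triples_le_quarter_square:
  assumes "\<forall>e\<in>F. card e = 2" "finite F" "\<forall>v. 2 * card (star F v) \<le> card F"
  shows "4 * real (card (wedge_triples F)) \<le> (real (card F))\<^sup>2"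
  using assms
proof (induction "card F" arbitrary: F rule: less_induct)
  case less
  note F = less.prems(1,2)
  obtain v where v: "\<And>w. card (star F w) \<le> card (star F v)"
  proof -
    have "\<forall>w. card (star F w) \<le> card F" using F by (auto simp: star_def intro: card_mono)
    then show ?thesis using that ex_has_greatest_nat[of "\<lambda>_. True" undefined "\<lambda>w. card (star F w)" "Suc (card F)"]
      by (auto simp: less_Suc_eq_le)
  qed
  define d where "d = card (star F v)"
  define F' where "F' = F - star F v"
  have F': "\<forall>e\<in>F'. card e = 2" "finite F'" using F by (auto simp: F'_def)
  have c: "card F' + d = card F" using card_Diff_star[OF F(2), of v] by (simp add: F'_def d_def)
  have ds: "2 * d \<le> card F" using less.prems by (simp add: d_def)
  have star_mono: "card (star F' w) \<le> d" for w
  proof -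
    have "card (star F' w) \<le> card (star F w)"
      using F by (intro card_mono) (auto simp: F'_def star_def)
    then show ?thesis using v[of w] by (simp add: d_def)
  qed
  show ?case
  proof (cases "d \<ge> 2")
    case False
    have "wedge_triples F = {}"
    proof (rule ccontr)
      assume "wedge_triples F \<noteq> {}"
      then obtain X e e' where e: "card X = 3" "e \<in> F" "e' \<in> F" "e \<noteq> e'" "e \<subseteq> X" "e' \<subseteq> X"
        by (auto simp: wedge_triples_def)
      have "e \<inter> e' \<noteq> {}"
      proof
        assume "e \<inter> e' = {}"
        moreover have "finite e" "finite e'" using e F by (auto intro: card_ge_0_finite)
        ultimately have "card (e \<union> e') = 4" using e F by (simp add: card_Un_disjoint)
        moreover have "e \<union> e' = X" using card_two_subset_union e F by metis
        ultimately show False using e by simp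
      qed
      then obtain w where "w \<in> e" "w \<in> e'" by auto
      then have "card {e, e'} \<le> card (star F w)" using e F by (intro card_mono) (auto simp: star_def)
      then show False using v[of w] False e by (simp add: d_def)
    qed
    then show ?thesis by simp
  next
    case True
    have step: "real (card (wedge_triples F)) \<le> real d * (real d - 1) / 2 + real (card F') + real (card (wedge_triples F'))"
      using card_wedge_triples_step[OF F, of v] unfolding d_def[symmetric] F'_def[symmetric]
      by (simp flip: real_choose_two of_nat_add)
    define s where "s = real (card F)"
    define D where "D = real d"
    have s': "real (card F') = s - D" using c by (simp add: s_def D_def flip: of_nat_add)
    have DD: "D \<ge> 2" "2 * D \<le> s" using True ds by (auto simp: D_def s_def)
    have case1: ?thesis if "4 * real (card (wedge_triples F')) \<le> (s - D)\<^sup>2"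
    proof -
      have "4 * real (card (wedge_triples F)) \<le> 2 * D * (D - 1) + 4 * (s - D) + (s - D)\<^sup>2"
        using step that s' by (simp add: D_def)
      \<comment> \<open>The excess over \<open>s\<^sup>2\<close> factors and is nonpositive, because
        \<open>D \<ge> 2\<close> and \<open>3 * D \<le> 2 * s\<close>.\<close>
      also have "\<dots> = s\<^sup>2 + (D - 2) * (3 * D - 2 * s)" by (simp add: power2_eq_square algebra_simps)
      also have "\<dots> \<le> s\<^sup>2" using DD by (simp add: mult_nonneg_nonpos)
      finally show ?thesis by (simp add: s_def)
    qed
    show ?thesis
    proof (cases "\<forall>w. 2 * card (star F' w) \<le> card F'")
      case True
      have "card F' < card F" using c \<open>d \<ge> 2\<close> by simp
      then show ?thesis using less.hyps[OF _ F' True] case1 s' by simp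
    next
      case False
      then obtain w where w: "card F' < 2 * card (star F' w)" by (auto simp: not_le)
      define x where "x = real (card (star F' w))"
      have x: "s - D < 2 * x" "x \<le> D"
        using w s' star_mono[of w] by (auto simp: x_def D_def)
      have b: "2 * real (card (wedge_triples F')) \<le> x\<^sup>2 + (s - D - x)\<^sup>2 + (s - D) - 2 * x"
        by (rule card_wedge_triples_star_bound[OF F', of _ w]) (auto simp: x_def s')
      \<comment> \<open>Integrality sharpens the strict inequality by one, which the factor
        \<open>D + x - (s - D) - 1\<close> below requires.\<close>
      have x1: "s - D + 1 \<le> 2 * x"
      proof -
        have "card F' + 1 \<le> 2 * card (star F' w)" using w by simp
        then have "real (card F' + 1) \<le> real (2 * card (star F' w))" by (rule of_nat_mono)
        then show ?thesis using s' by (simp add: x_def)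
      qed
      \<comment> \<open>By this product, replacing \<open>x\<close> by \<open>D\<close> in
        \<open>b\<close> only weakens the bound. At \<open>x = D\<close> the resulting bound exceeds
        \<open>s\<^sup>2\<close> by twice the next product, which is nonpositive since
        \<open>s \<le> 3 * D - 1\<close> and \<open>D \<ge> 2\<close>.\<close>
      have "0 \<le> (D - x) * (D + x - (s - D) - 1)"
        using x x1 by (intro mult_nonneg_nonneg) auto
      moreover have "(s - 2 * D) * (s / 2 - 3 * D + 3) \<le> 0"
        using x x1 DD by (intro mult_nonneg_nonpos) auto
      ultimately have "4 * real (card (wedge_triples F)) \<le> s\<^sup>2"
        using b step s' unfolding D_def[symmetric] by (simp add: power2_eq_square field_simps)
      then show ?thesis by (simp add: s_def)
    qed
  qed
qed

section \<open>Adjacency sums and Goodman's identity\<close>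

definition adj :: "'a set set \<Rightarrow> 'a \<Rightarrow> 'a \<Rightarrow> real" where
  "adj E u v = of_bool ({u, v} \<in> E)"

lemma adj_commute: "adj E u v = adj E v u"
  by (simp add: adj_def insert_commute)

lemma sum_adj_singleton:
  assumes "finite A" "card e = 2" "e \<subseteq> A"
  shows "(\<Sum>u\<in>A. \<Sum>v\<in>A. adj {e} u v) = 2"
proof -
  obtain x y where e: "e = {x, y}" "x \<noteq> y" using assms(2) by (auto simp: card_2_iff)
  have "(\<Sum>u\<in>A. \<Sum>v\<in>A. adj {e} u v) = (\<Sum>p\<in>A\<times>A. of_bool ({fst p, snd p} = e))"
    by (simp add: sum.cartesian_product adj_def case_prod_beta)
  also have "\<dots> = (\<Sum>p\<in>{(x, y), (y, x)}. of_bool ({fst p, snd p} = e))"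
    using assms e by (intro sum.mono_neutral_right) (auto simp: doubleton_eq_iff)
  also have "\<dots> = 2" using e by (auto simp: doubleton_eq_iff)
  finally show ?thesis .
qed

lemma sum_adj:
  assumes A: "finite A" and E: "\<forall>e\<in>E. card e = 2"
  shows "(\<Sum>u\<in>A. \<Sum>v\<in>A. adj E u v) = 2 * real (card (E \<inter> nsets A 2))"
proof -
  let ?S = "E \<inter> nsets A 2"
  have fin: "finite ?S" using A by (simp add: finite_imp_finite_nsets)
  have "adj E u v = (\<Sum>e\<in>?S. adj {e} u v)" if "u \<in> A" "v \<in> A" for u v
  proof -
    have "{u, v} \<in> E \<longleftrightarrow> {u, v} \<in> ?S" using that E by (auto simp: nsets_def)
    then show ?thesis using fin by (simp add: adj_def of_bool_def sum.delta)
  qed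
  then have "(\<Sum>u\<in>A. \<Sum>v\<in>A. adj E u v) = (\<Sum>u\<in>A. \<Sum>v\<in>A. \<Sum>e\<in>?S. adj {e} u v)"
    by simp
  also have "\<dots> = (\<Sum>e\<in>?S. \<Sum>u\<in>A. \<Sum>v\<in>A. adj {e} u v)"
  proof -
    have "(\<Sum>u\<in>A. \<Sum>v\<in>A. \<Sum>e\<in>?S. adj {e} u v) = (\<Sum>u\<in>A. \<Sum>e\<in>?S. \<Sum>v\<in>A. adj {e} u v)"
      by (intro sum.cong refl sum.swap)
    then show ?thesis by (simp only: sum.swap[of _ ?S A])
  qed
  also have "\<dots> = (\<Sum>e\<in>?S. 2)"
    using A by (intro sum.cong refl sum_adj_singleton) (auto simp: nsets_def)
  finally show ?thesis by simp
qed

lemma card_orderings_le: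
  assumes "card X = 3"
  shows "card {(u, v, w). {u, v, w} = X} \<le> 6"
proof -
  obtain x y z where X: "X = {x, y, z}" "x \<noteq> y" "y \<noteq> z" "x \<noteq> z"
    using assms by (auto simp: card_3_iff)
  have "{(u, v, w). {u, v, w} = X} \<subseteq> set [(x,y,z), (x,z,y), (y,x,z), (y,z,x), (z,x,y), (z,y,x)]"
  proof
    fix p assume "p \<in> {(u, v, w). {u, v, w} = X}"
    then obtain u v w where p: "p = (u, v, w)" and eq: "{u, v, w} = X" by blast
    then have "u \<in> {x, y, z}" "v \<in> {x, y, z}" "w \<in> {x, y, z}" using X(1) by blast+
    moreover have "u \<noteq> v \<and> u \<noteq> w \<and> v \<noteq> w"
      using assms unfolding eq[symmetric] by (auto simp: card_insert_if split: if_splits)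
    ultimately show "p \<in> set [(x,y,z), (x,z,y), (y,x,z), (y,z,x), (z,x,y), (z,y,x)]"
      unfolding p by auto
  qed
  then have "card {(u, v, w). {u, v, w} = X} \<le> card (set [(x,y,z), (x,z,y), (y,x,z), (y,z,x), (z,x,y), (z,y,x)])"
    by (intro card_mono) auto
  also have "\<dots> \<le> 6" by (rule order_trans[OF card_length]) simp
  finally show ?thesis .
qed

lemma finite_triangles:
  assumes "finite V" "E \<subseteq> nsets V 2"
  shows "finite (triangles E)"
proof (rule finite_subset)
  show "triangles E \<subseteq> Pow V"
  proof
    fix X assume "X \<in> triangles E"
    then have X: "card X = 3" "nsets X 2 \<subseteq> nsets V 2" using assms by (auto simp: triangles_def)
    then obtain x y z where "X = {x, y, z}" "x \<noteq> y" "y \<noteq> z" "x \<noteq> z" by (auto simp: card_3_iff)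
    then have e: "{x, y} \<in> nsets X 2" "{y, z} \<in> nsets X 2" and un: "X = {x, y} \<union> {y, z}"
      by (auto simp: nsets_def)
    have "{x, y} \<in> nsets V 2" "{y, z} \<in> nsets V 2" using X(2) e by blast+
    then have "{x, y} \<subseteq> V" "{y, z} \<subseteq> V" by (simp_all add: nsets_def)
    then show "X \<in> Pow V" unfolding un by blast
  qed
qed (use assms in auto)

text \<open>A nonzero summand forces three distinct vertices spanning a triangle, and each triangle
  arises from at most six ordered triples.\<close>

lemma sum_adj_triangles_le:
  assumes V: "finite V" "E \<subseteq> nsets V 2"
  shows "(\<Sum>u\<in>V. \<Sum>v\<in>V. \<Sum>w\<in>V. adj E u v * adj E u w * adj E v w) \<le> 6 * real (card (triangles E))"
proof -
  let ?P = "{(u, v, w). {u, v, w} \<in> triangles E}"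
  have E2: "\<forall>e\<in>E. card e = 2" using V by (auto simp: nsets_def)
  have fT: "finite (triangles E)" using finite_triangles V .
  have P: "?P = (\<Union>X\<in>triangles E. {(u, v, w). {u, v, w} = X})" by auto
  have fP: "finite ?P" unfolding P
  proof (intro finite_UN_I fT)
    fix X assume "X \<in> triangles E"
    then have "finite X" by (simp add: triangles_def card_ge_0_finite)
    then have "finite (X \<times> X \<times> X)" by simp
    then show "finite {(u, v, w). {u, v, w} = X}" by (rule finite_subset[rotated]) auto
  qed
  have "(\<Sum>u\<in>V. \<Sum>v\<in>V. \<Sum>w\<in>V. adj E u v * adj E u w * adj E v w)
      = (\<Sum>(u, v, w)\<in>V\<times>V\<times>V. adj E u v * adj E u w * adj E v w)"
    by (simp add: sum.cartesian_product)
  also have "\<dots> \<le> (\<Sum>(u, v, w)\<in>V\<times>V\<times>V. of_bool ((u, v, w) \<in> ?P))"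
  proof -
    have "adj E u v * adj E u w * adj E v w \<le> of_bool ((u, v, w) \<in> ?P)" for u v w
    proof (cases "{u, v} \<in> E \<and> {u, w} \<in> E \<and> {v, w} \<in> E")
      case True
      then have "card {u, v} = 2" "card {u, w} = 2" "card {v, w} = 2" using E2 by auto
      then have ne: "u \<noteq> v" "u \<noteq> w" "v \<noteq> w" by auto
      have "e \<in> E" if "e \<in> nsets {u, v, w} 2" for e
      proof -
        from that obtain a b where "e = {a, b}" "a \<noteq> b" "a \<in> {u, v, w}" "b \<in> {u, v, w}"
          by (auto simp: nsets_def card_2_iff)
        then show ?thesis using True by (auto simp: insert_commute)
      qed
      then have "{u, v, w} \<in> triangles E" using ne by (auto simp: triangles_def)
      then show ?thesis by (simp add: adj_def)
    qed (auto simp: adj_def)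
    then show ?thesis by (intro sum_mono) (simp only: split_paired_all prod.case)
  qed
  also have "\<dots> = (\<Sum>p\<in>V\<times>V\<times>V. of_bool (p \<in> ?P))" by (intro sum.cong) auto
  also have "\<dots> = real (card ((V\<times>V\<times>V) \<inter> ?P))"
    using V by (simp add: of_bool_def sum.If_cases)
  also have "\<dots> \<le> real (card ?P)" using fP by (intro of_nat_mono card_mono) auto
  also have "\<dots> \<le> real (\<Sum>X\<in>triangles E. card {(u, v, w). {u, v, w} = X})"
    unfolding P by (intro of_nat_mono card_UN_le fT)
  also have "\<dots> \<le> real (\<Sum>X\<in>triangles E. 6)"
    by (intro of_nat_mono sum_mono card_orderings_le) (auto simp: triangles_def)
  finally show ?thesis by simp
qed

text \<open>Goodman's identity; the last sum counts the triples spanning exactly one edge.\<close>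

lemma sum_triangles_identity:
  fixes a :: "'a \<Rightarrow> 'a \<Rightarrow> real"
  assumes sym: "\<And>u v. a u v = a v u"
  shows "(\<Sum>u\<in>V. \<Sum>v\<in>V. \<Sum>w\<in>V. a u v * a u w * a v w) =
    2 * (\<Sum>u\<in>V. (\<Sum>v\<in>V. a u v)\<^sup>2) - real (card V) * (\<Sum>u\<in>V. \<Sum>v\<in>V. a u v)
    + (\<Sum>u\<in>V. \<Sum>v\<in>V. \<Sum>w\<in>V. a u v * (1 - a u w) * (1 - a v w))"
proof -
  \<comment> \<open>A polynomial identity valid for all reals, from expanding the last product.
    Summed, both quadratic terms give the sum of squared degrees; the second needs symmetry of
    \<open>a\<close>.\<close>
  have p: "a u v * a u w * a v w =
      a u v * a u w + a u v * a v w - a u v + a u v * (1 - a u w) * (1 - a v w)" for u v w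
    by (simp add: algebra_simps)
  have 1: "(\<Sum>u\<in>V. \<Sum>v\<in>V. \<Sum>w\<in>V. a u v * a u w) = (\<Sum>u\<in>V. (\<Sum>v\<in>V. a u v)\<^sup>2)"
    by (simp add: power2_eq_square sum_product)
  have "(\<Sum>u\<in>V. \<Sum>v\<in>V. \<Sum>w\<in>V. a u v * a v w) = (\<Sum>v\<in>V. \<Sum>u\<in>V. \<Sum>w\<in>V. a u v * a v w)"
    by (rule sum.swap)
  also have "\<dots> = (\<Sum>v\<in>V. \<Sum>u\<in>V. \<Sum>w\<in>V. a v u * a v w)"
    by (intro sum.cong refl arg_cong2[where f = "(*)"] sym)
  finally have "(\<Sum>u\<in>V. \<Sum>v\<in>V. \<Sum>w\<in>V. a u v * a v w) = (\<Sum>v\<in>V. \<Sum>u\<in>V. \<Sum>w\<in>V. a v u * a v w)" .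
  then have 2: "(\<Sum>u\<in>V. \<Sum>v\<in>V. \<Sum>w\<in>V. a u v * a v w) = (\<Sum>u\<in>V. (\<Sum>v\<in>V. a u v)\<^sup>2)"
    by (simp add: power2_eq_square sum_product)
  have 3: "(\<Sum>u\<in>V. \<Sum>v\<in>V. \<Sum>w\<in>V. a u v) = real (card V) * (\<Sum>u\<in>V. \<Sum>v\<in>V. a u v)"
    by (simp add: sum_distrib_left)
  show ?thesis
    unfolding p sum.distrib sum_subtractf 1 2 3 by simp
qed

section \<open>One-edge triples from two leaf sets, and the lower bound on triangles\<close>

text \<open>For values 0 and 1, \<open>a * (1 - b) * (1 - c) \<ge> a - b - c\<close>: an edge inside
  \<open>A\<close> and a vertex of \<open>B\<close> form a one-edge triple unless a cross edge
  spoils it. Each of the two subtracted terms sums to at most \<open>card A * c\<close>.\<close>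

lemma sum_single_edge_triples_block:
  assumes fin: "finite A" "finite B" and E: "\<forall>e\<in>E. card e = 2"
    and cross: "(\<Sum>u\<in>A. \<Sum>w\<in>B. adj E u w) \<le> c"
  shows "2 * real (card (E \<inter> nsets A 2)) * real (card B) - 2 * real (card A) * c
    \<le> (\<Sum>u\<in>A. \<Sum>v\<in>A. \<Sum>w\<in>B. adj E u v * (1 - adj E u w) * (1 - adj E v w))"
proof -
  let ?a = "adj E"
  have "(\<Sum>u\<in>A. \<Sum>v\<in>A. \<Sum>w\<in>B. ?a u v - ?a u w - ?a v w)
    \<le> (\<Sum>u\<in>A. \<Sum>v\<in>A. \<Sum>w\<in>B. ?a u v * (1 - ?a u w) * (1 - ?a v w))"
    by (intro sum_mono) (auto simp: adj_def)
  moreover have "(\<Sum>u\<in>A. \<Sum>v\<in>A. \<Sum>w\<in>B. ?a u v) = 2 * real (card (E \<inter> nsets A 2)) * real (card B)"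
    using sum_adj[OF fin(1) E] by (simp flip: sum_distrib_left)
  moreover have "(\<Sum>u\<in>A. \<Sum>v\<in>A. \<Sum>w\<in>B. ?a u w) \<le> real (card A) * c"
    using cross by (simp flip: sum_distrib_left add: mult_left_mono)
  moreover have "(\<Sum>u\<in>A. \<Sum>v\<in>A. \<Sum>w\<in>B. ?a v w) \<le> real (card A) * c"
    using cross by (simp add: mult_left_mono)
  ultimately show ?thesis by (simp add: sum_subtractf)
qed

text \<open>The boxes \<open>A\<times>A\<times>B\<close> and \<open>B\<times>B\<times>A\<close> are
  disjoint and all summands are nonnegative, so the two block estimates add up inside the full
  sum.\<close>

lemma sum_single_edge_triples_ge:
  assumes V: "finite V" "A \<subseteq> V" "B \<subseteq> V" "A \<inter> B = {}" and E: "\<forall>e\<in>E. card e = 2"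
    and cross: "(\<Sum>u\<in>A. \<Sum>w\<in>B. adj E u w) \<le> c"
  shows "2 * real (card (E \<inter> nsets A 2)) * real (card B) + 2 * real (card (E \<inter> nsets B 2)) * real (card A)
      - 2 * (real (card A) + real (card B)) * c
    \<le> (\<Sum>u\<in>V. \<Sum>v\<in>V. \<Sum>w\<in>V. adj E u v * (1 - adj E u w) * (1 - adj E v w))"
proof -
  let ?h = "\<lambda>u v w. adj E u v * (1 - adj E u w) * (1 - adj E v w)"
  have nn: "0 \<le> ?h u v w" for u v w by (auto simp: adj_def)
  have fin: "finite A" "finite B" using V finite_subset by blast+
  have "(\<Sum>u\<in>B. \<Sum>w\<in>A. adj E u w) = (\<Sum>w\<in>A. \<Sum>u\<in>B. adj E u w)" by (rule sum.swap)
  also have "\<dots> = (\<Sum>u\<in>A. \<Sum>w\<in>B. adj E u w)" by (intro sum.cong refl adj_commute)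
  finally have "(\<Sum>u\<in>B. \<Sum>w\<in>A. adj E u w) = (\<Sum>u\<in>A. \<Sum>w\<in>B. adj E u w)" .
  then have cross': "(\<Sum>u\<in>B. \<Sum>w\<in>A. adj E u w) \<le> c" using cross by simp
  have c3: "(\<Sum>u\<in>S. \<Sum>v\<in>S. \<Sum>w\<in>T. ?h u v w) = (\<Sum>(u, v, w)\<in>S\<times>S\<times>T. ?h u v w)" for S T
    by (simp add: sum.cartesian_product)
  have "(\<Sum>u\<in>A. \<Sum>v\<in>A. \<Sum>w\<in>B. ?h u v w) + (\<Sum>u\<in>B. \<Sum>v\<in>B. \<Sum>w\<in>A. ?h u v w)
      = (\<Sum>(u, v, w)\<in>A\<times>A\<times>B \<union> B\<times>B\<times>A. ?h u v w)"
    unfolding c3 using fin V(4) by (intro sum.union_disjoint[symmetric] finite_cartesian_product) blast+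
  also have "\<dots> \<le> (\<Sum>(u, v, w)\<in>V\<times>V\<times>V. ?h u v w)"
  proof (rule sum_mono2)
    show "A\<times>A\<times>B \<union> B\<times>B\<times>A \<subseteq> V\<times>V\<times>V" using V(2,3) by blast
  qed (use V(1) nn in \<open>simp_all add: case_prod_beta\<close>)
  finally have "(\<Sum>u\<in>A. \<Sum>v\<in>A. \<Sum>w\<in>B. ?h u v w) + (\<Sum>u\<in>B. \<Sum>v\<in>B. \<Sum>w\<in>A. ?h u v w)
      \<le> (\<Sum>u\<in>V. \<Sum>v\<in>V. \<Sum>w\<in>V. ?h u v w)" unfolding c3 .
  then show ?thesis
    using sum_single_edge_triples_block[OF fin E cross] sum_single_edge_triples_block[OF fin(2,1) E cross']
    by (simp add: algebra_simps)
qed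

text \<open>Goodman's identity, with Cauchy-Schwarz applied to the degree sum
  \<open>2 * m\<close>.\<close>

lemma triangles_ge:
  assumes V: "finite V" "V \<noteq> {}" and E: "E \<subseteq> nsets V 2"
    and p: "p \<le> (\<Sum>u\<in>V. \<Sum>v\<in>V. \<Sum>w\<in>V. adj E u v * (1 - adj E u w) * (1 - adj E v w))"
    and m: "m = real (card E)" and n: "n = real (card V)"
  shows "8 * m\<^sup>2 / n - 2 * m * n + p \<le> 6 * real (card (triangles E))"
proof -
  have E2: "\<forall>e\<in>E. card e = 2" using E by (auto simp: nsets_def)
  have npos: "n > 0" using V n by (simp add: card_gt_0_iff)
  have deg: "(\<Sum>u\<in>V. \<Sum>v\<in>V. adj E u v) = 2 * m"
    using sum_adj[OF V(1) E2] E m by (simp add: Int_absorb2)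
  have "(\<Sum>u\<in>V. \<Sum>v\<in>V. adj E u v)\<^sup>2 \<le> (\<Sum>u\<in>V. (\<Sum>v\<in>V. adj E u v)\<^sup>2) * n"
    unfolding n by (rule sum_squared_le_sum_of_squares)
  then have "4 * m\<^sup>2 / n \<le> (\<Sum>u\<in>V. (\<Sum>v\<in>V. adj E u v)\<^sup>2)"
    using npos unfolding deg by (simp add: field_simps)
  then show ?thesis
    using sum_adj_triangles_le[OF V(1) E] p
      sum_triangles_identity[of "adj E" V, OF adj_commute] n deg by (simp add: algebra_simps)
qed

section \<open>Structure of a colour with many triangles\<close>

text \<open>Since \<open>\<epsilon> < 1 / 2\<close>, the count exceeds \<open>s\<^sup>2 / 4\<close>,
  so some degree \<open>d\<close> is above \<open>s / 2\<close>. The star bound then gives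
  \<open>(2 * d - s)\<^sup>2 \<ge> (lam * s)\<^sup>2\<close>, and \<open>2 * d > s\<close> selects
  the positive root.\<close>

lemma exists_large_star:
  assumes F: "\<forall>e\<in>F. card e = 2" "finite F" and s: "s = real (card F)" "s > 0"
    and eps: "\<epsilon> < 1 / 2" and lam: "lam = sqrt (1 - 2 * \<epsilon>)"
    and many: "(1 - \<epsilon>) * s\<^sup>2 / 2 \<le> real (card (wedge_triples F))"
  obtains v where "(1 + lam) * s / 2 \<le> real (card (star F v))"
proof -
  have "s\<^sup>2 < (2 - 2 * \<epsilon>) * s\<^sup>2" using s(2) eps by simp
  also have "\<dots> \<le> 4 * real (card (wedge_triples F))" using many by (simp add: algebra_simps)
  finally have "\<not> 4 * real (card (wedge_triples F)) \<le> (real (card F))\<^sup>2" using s(1) by simp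
  then have "\<not> (\<forall>v. 2 * card (star F v) \<le> card F)"
    using card_wedge_triples_le_quarter_square[OF F] by blast
  then obtain v where v: "card F < 2 * card (star F v)" by (auto simp: not_le)
  define d where "d = real (card (star F v))"
  have d: "s < 2 * d" using v by (simp add: d_def s)
  have "2 * real (card (wedge_triples F)) \<le> d\<^sup>2 + (s - d)\<^sup>2 + s - 2 * d"
    by (rule card_wedge_triples_star_bound[OF F d_def s(1)])
  then have "(1 - \<epsilon>) * s\<^sup>2 \<le> d\<^sup>2 + (s - d)\<^sup>2" using many d by simp
  then have "(1 - 2 * \<epsilon>) * s\<^sup>2 \<le> (2 * d - s)\<^sup>2" by (simp add: power2_eq_square algebra_simps)
  moreover have "lam\<^sup>2 = 1 - 2 * \<epsilon>" using lam eps by simp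
  ultimately have "(lam * s)\<^sup>2 \<le> (2 * d - s)\<^sup>2" by (simp add: power_mult_distrib)
  then have "lam * s \<le> 2 * d - s" by (rule power2_le_imp_le) (use d in simp)
  then show ?thesis using that[of v] by (simp add: d_def algebra_simps)
qed

text \<open>A triangle counted in \<open>k\<close> that does not come from an edge of
  \<open>E\<close> between leaves involves one of the \<open>q\<close> edges off the star; there are
  at most \<open>q + q * (q - 1) / 2\<close> such triangles.\<close>

lemma card_edges_nbhd_ge:
  assumes F: "\<forall>e\<in>F. card e = 2" "finite F"
    and many: "k \<le> real (card (wedge_triples F \<inter> triangles E))"
    and q: "q = real (card (F - star F v))"
  shows "k - (q\<^sup>2 + q) / 2 \<le> real (card (E \<inter> nsets (nbhd F v) 2))"
proof -
  have "card (wedge_triples F \<inter> triangles E) \<le>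
      card (E \<inter> nsets (nbhd F v) 2) + card (F - star F v) + card (wedge_triples (F - star F v))"
  proof (rule card_wedge_triples_Int_le[OF F])
    fix X assume "X \<in> triangles E"
    then have "nsets X 2 \<subseteq> E" unfolding triangles_def by blast
    then show "nsets X 2 \<inter> nsets (nbhd F v) 2 \<subseteq> E" by blast
  qed
  moreover have "card (wedge_triples (F - star F v)) \<le> card (F - star F v) choose 2"
    using F by (intro card_wedge_triples_le) auto
  ultimately have "card (wedge_triples F \<inter> triangles E) \<le>
      card (E \<inter> nsets (nbhd F v) 2) + card (F - star F v) + (card (F - star F v) choose 2)"
    by linarith
  then have "real (card (wedge_triples F \<inter> triangles E)) \<le> real (card (E \<inter> nsets (nbhd F v) 2))
      + real (card (F - star F v)) + real (card (F - star F v) choose 2)"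
    by linarith
  then have "real (card (wedge_triples F \<inter> triangles E)) \<le>
      real (card (E \<inter> nsets (nbhd F v) 2)) + q + q * (q - 1) / 2"
    unfolding real_choose_two q[symmetric] .
  moreover have "q + q * (q - 1) / 2 = (q\<^sup>2 + q) / 2" by (simp add: power2_eq_square field_simps)
  ultimately show ?thesis using many by linarith
qed

section \<open>Monotonicity of the numerical conditions; edges between two leaf sets\<close>

text \<open>The quadratic has nonnegative derivative at \<open>y\<close>, hence does not decrease
  beyond it, and a larger \<open>u\<close> only shrinks the linear coefficient. This carries the
  hypotheses from \<open>1 + \<delta>\<close> and \<open>t\<close> to the actual ratios.\<close>

lemma quadratic_pos_mono:
  fixes x y t u b c :: real
  assumes "8 / 3 * y\<^sup>2 - (2 / (3 * t) + c) * y + b > 0" "16 / 3 * y \<ge> 2 / (3 * t) + c"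
    and "0 < y" "y \<le> x" "0 < t" "t \<le> u"
  shows "8 / 3 * x\<^sup>2 - (2 / (3 * u) + c) * x + b > 0"
proof -
  have "0 \<le> (x - y) * (8 / 3 * (x - y) + (16 / 3 * y - (2 / (3 * t) + c)))"
    using assms by (intro mult_nonneg_nonneg) auto
  also have "\<dots> = 8 / 3 * x\<^sup>2 - (2 / (3 * t) + c) * x - (8 / 3 * y\<^sup>2 - (2 / (3 * t) + c) * y)"
    using assms(5) by (simp add: power2_eq_square field_simps)
  finally have "8 / 3 * x\<^sup>2 - (2 / (3 * t) + c) * x + b > 0" using assms(1) by simp
  moreover have "2 / (3 * u) * x \<le> 2 / (3 * t) * x"
    using assms by (intro mult_right_mono divide_left_mono) auto
  ultimately show ?thesis by (simp add: algebra_simps)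
qed

text \<open>Used for leaves \<open>a\<close>, \<open>b\<close> of two stars of different colours
  with common centre \<open>v\<close>: the first alternative is then impossible, so
  \<open>{a, b}\<close> shares its colour with a side at \<open>v\<close>.\<close>

lemma triangle_mem_wedge_triples:
  assumes F: "\<forall>e\<in>F. card e = 2" and X: "{v, a, b} \<in> wedge_triples F"
  shows "{v, a} \<in> F \<and> {v, b} \<in> F \<or> {a, b} \<in> F \<and> ({v, a} \<in> F \<or> {v, b} \<in> F)"
proof -
  have sub: "e = {v, a} \<or> e = {v, b} \<or> e = {a, b}" if "e \<in> F" "e \<subseteq> {v, a, b}" for e
  proof -
    have "card e = 2" using F \<open>e \<in> F\<close> by blast
    then obtain x y where "e = {x, y}" "x \<noteq> y" by (auto simp: card_2_iff)
    moreover from this have "x \<in> {v, a, b}" "y \<in> {v, a, b}" using \<open>e \<subseteq> {v, a, b}\<close> by blast+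
    ultimately show ?thesis by (elim insertE emptyE) (simp_all add: insert_commute)
  qed
  obtain e e' where e: "e \<in> F" "e' \<in> F" "e \<noteq> e'" "e \<subseteq> {v, a, b}" "e' \<subseteq> {v, a, b}"
    using X by (auto simp: wedge_triples_def)
  show ?thesis using sub[OF e(1,4)] sub[OF e(2,5)] e(1-3) by (elim disjE) simp_all
qed

text \<open>Disjointness of \<open>A\<close> and \<open>B\<close> makes the map from pairs to edges
  injective, so each edge of \<open>S\<close> is counted at most once.\<close>

lemma sum_adj_cross_le:
  assumes fin: "finite A" "finite B" "finite S" and disj: "A \<inter> B = {}"
    and sub: "\<And>a b. a \<in> A \<Longrightarrow> b \<in> B \<Longrightarrow> {a, b} \<in> E \<Longrightarrow> {a, b} \<in> S"
  shows "(\<Sum>u\<in>A. \<Sum>w\<in>B. adj E u w) \<le> real (card S)"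
proof -
  let ?P = "{p \<in> A \<times> B. {fst p, snd p} \<in> E}"
  have "(\<Sum>u\<in>A. \<Sum>w\<in>B. adj E u w) = (\<Sum>p\<in>A\<times>B. of_bool ({fst p, snd p} \<in> E))"
    by (simp add: sum.cartesian_product adj_def case_prod_beta)
  also have "\<dots> = real (card ?P)"
    using fin by (simp add: of_bool_def sum.If_cases Int_def)
  also have "card ?P \<le> card S"
  proof (rule card_inj_on_le)
    show "inj_on (\<lambda>p. {fst p, snd p}) ?P"
      using disj by (auto simp: inj_on_def doubleton_eq_iff)
    show "(\<lambda>p. {fst p, snd p}) ` ?P \<subseteq> S" using sub by auto
  qed (use fin in auto)
  finally show ?thesis by simp
qed

section \<open>Contradiction for disjoint colour classes of equal size\<close>

text \<open>The colouring is replaced by disjoint edge sets \<open>F i\<close>, and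
  \<open>tri\<close> expresses that no triangle is rainbow. With \<open>y = 1 + \<delta>\<close>,
  the conditions \<open>c1\<close>, \<open>c2\<close>, \<open>c3\<close> are the three numerical
  hypotheses, rearranged as quadratics in \<open>y\<close> and a bound on its derivative.\<close>

lemma no_uniform_rainbow_free_family:
  fixes I :: "nat set" and F :: "nat \<Rightarrow> 'a set set" and V :: "'a set" and \<epsilon> lam t y :: real
  defines "E \<equiv> \<Union>i\<in>I. F i"
  assumes V: "finite V" "V \<noteq> {}" and I: "finite I"
    and FV: "\<And>i. i \<in> I \<Longrightarrow> F i \<subseteq> nsets V 2" and Fs: "\<And>i. i \<in> I \<Longrightarrow> card (F i) = s"
    and disj: "\<And>i j. i \<in> I \<Longrightarrow> j \<in> I \<Longrightarrow> i \<noteq> j \<Longrightarrow> F i \<inter> F j = {}"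
    and tri: "triangles E \<subseteq> (\<Union>i\<in>I. wedge_triples (F i))"
    and t: "0 < t" "t * real (card V) \<le> real s"
    and y: "1 < y" "y * real (card V) \<le> real (card I)"
    and eps: "0 < \<epsilon>" "\<epsilon> < 1 / 2" and lam: "lam = sqrt (1 - 2 * \<epsilon>)"
    and c1: "8 / 3 * y\<^sup>2 - (2 / (3 * t) + (1 - \<epsilon>)) * y - \<epsilon> > 0"
    and c2: "8 / 3 * y\<^sup>2 - (2 / (3 * t) + 1) * y + t / 12 * (lam + 1) * (4 * (1 - \<epsilon>) - (1 - lam)\<^sup>2) > 0"
    and c3: "16 / 3 * y > 2 / (3 * t) + 1"
  shows False
proof -
  define n where "n = real (card V)"
  define N where "N = real (card I)"
  define S where "S = real s"
  define x where "x = N / n"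
  define u where "u = S / n"
  define T where "T = real (card (triangles E))"
  have n: "n > 0" using V by (simp add: n_def card_gt_0_iff)
  have tn: "t * n \<le> S" using t by (simp add: n_def S_def)
  have yn: "y * n \<le> N" using y by (simp add: n_def N_def)
  have "0 < t * n" using t(1) n by simp
  then have S: "S > 0" using tn by linarith
  have "1 * n < y * n" using y(1) n by (intro mult_strict_right_mono) auto
  then have nN: "n < N" using yn by linarith
  have x: "y \<le> x" using yn n by (simp add: x_def field_simps)
  have u: "t \<le> u" using tn n by (simp add: u_def field_simps)
  have F2: "\<forall>e\<in>F i. card e = 2" if "i \<in> I" for i using FV[OF that] by (auto simp: nsets_def)
  have Ff: "finite (F i)" if "i \<in> I" for i
    using finite_subset[OF FV[OF that]] V by (simp add: finite_imp_finite_nsets)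
  have EV: "E \<subseteq> nsets V 2" using FV by (auto simp: E_def)
  have E2: "\<forall>e\<in>E. card e = 2" using EV by (auto simp: nsets_def)
  have m: "real (card E) = N * S"
  proof -
    have "card E = (\<Sum>i\<in>I. card (F i))"
      unfolding E_def using I Ff disj by (intro card_UN_disjoint) auto
    then show ?thesis using Fs by (simp add: N_def S_def)
  qed
  \<comment> \<open>More than \<open>n\<close> disjoint classes of \<open>S\<close> edges fit into
    fewer than \<open>n\<^sup>2 / 2\<close> pairs. The final absorption of error terms relies on
    this.\<close>
  have Sn: "2 * S < n"
  proof -
    have "card E \<le> card (nsets V 2)"
      using EV V by (intro card_mono) (auto simp: finite_imp_finite_nsets)
    then have "real (card E) \<le> real (card V choose 2)" by simp
    then have "2 * (N * S) \<le> n * (n - 1)" unfolding real_choose_two m by (simp add: n_def)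
    also have "\<dots> < n * n" using n by simp
    finally have "N * (2 * S) < n * n" by simp
    also have "\<dots> \<le> N * n" using nN n by simp
    finally show ?thesis using nN n by simp
  qed
  have lam01: "0 \<le> lam" "lam \<le> 1" using lam eps by auto
  define \<tau> where "\<tau> i = real (card (wedge_triples (F i) \<inter> triangles E))" for i
  have \<tau>: "\<tau> i \<le> S * (S - 1) / 2" if "i \<in> I" for i
  proof -
    have "card (wedge_triples (F i) \<inter> triangles E) \<le> card (wedge_triples (F i))"
      using that by (intro card_mono finite_wedge_triples F2 Ff) auto
    also have "\<dots> \<le> s choose 2"
      using card_wedge_triples_le[OF F2 Ff] Fs that by metis
    finally have "\<tau> i \<le> real (s choose 2)" by (simp add: \<tau>_def)
    then show ?thesis unfolding real_choose_two S_def .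
  qed
  have T: "T \<le> (\<Sum>i\<in>I. \<tau> i)"
  proof -
    have "triangles E = (\<Union>i\<in>I. wedge_triples (F i) \<inter> triangles E)" using tri by blast
    then have "card (triangles E) \<le> (\<Sum>i\<in>I. card (wedge_triples (F i) \<inter> triangles E))"
      using card_UN_le[OF I] by metis
    then have "T \<le> real (\<Sum>i\<in>I. card (wedge_triples (F i) \<inter> triangles E))"
      unfolding T_def by (rule of_nat_mono)
    then show ?thesis by (simp add: \<tau>_def)
  qed
  have lower: "8 * (N * S)\<^sup>2 / n - 2 * (N * S) * n + p \<le> 6 * T"
    if "p \<le> (\<Sum>u\<in>V. \<Sum>v\<in>V. \<Sum>w\<in>V. adj E u v * (1 - adj E u w) * (1 - adj E v w))" for p
    using triangles_ge[OF V EV that refl refl] unfolding m T_def n_def .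

  define G where "G = {i \<in> I. (1 - \<epsilon>) * S\<^sup>2 / 2 \<le> \<tau> i}"
  have GI: "G \<subseteq> I" by (auto simp: G_def)
  \<comment> \<open>Otherwise at most \<open>n\<close> colours reach the maximal contribution
    \<open>S\<^sup>2 / 2\<close> and the others stay below
    \<open>(1 - \<epsilon>) * S\<^sup>2 / 2\<close>. Goodman's bound with \<open>p = 0\<close>,
    divided by \<open>3 * n * S\<^sup>2\<close>, then contradicts \<open>c1\<close>.\<close>
  have "card V < card G"
  proof (rule ccontr)
    assume "\<not> card V < card G"
    then have g: "real (card G) \<le> n" by (simp add: n_def)
    have "(\<Sum>i\<in>I. \<tau> i) \<le> (\<Sum>i\<in>I. (1 - \<epsilon>) * S\<^sup>2 / 2 + (if i \<in> G then \<epsilon> * S\<^sup>2 / 2 else 0))"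
    proof (intro sum_mono)
      fix i assume i: "i \<in> I"
      have "S * (S - 1) / 2 \<le> S\<^sup>2 / 2" using S by (simp add: power2_eq_square right_diff_distrib)
      then have "\<tau> i \<le> S\<^sup>2 / 2" using \<tau>[OF i] by linarith
      moreover have "S\<^sup>2 / 2 = (1 - \<epsilon>) * S\<^sup>2 / 2 + \<epsilon> * S\<^sup>2 / 2" by (simp add: field_simps)
      moreover have "\<tau> i \<le> (1 - \<epsilon>) * S\<^sup>2 / 2" if "i \<notin> G" using that i by (simp add: G_def)
      ultimately show "\<tau> i \<le> (1 - \<epsilon>) * S\<^sup>2 / 2 + (if i \<in> G then \<epsilon> * S\<^sup>2 / 2 else 0)"
        by (cases "i \<in> G") (simp_all only: if_True if_False add_0_right not_False_eq_True simp_thms)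
    qed
    also have "\<dots> = N * ((1 - \<epsilon>) * S\<^sup>2 / 2) + real (card G) * (\<epsilon> * S\<^sup>2 / 2)"
      using I GI by (simp add: sum.distrib sum.If_cases Int_absorb1 N_def)
    also have "\<dots> \<le> N * ((1 - \<epsilon>) * S\<^sup>2 / 2) + n * (\<epsilon> * S\<^sup>2 / 2)"
      using g eps by (intro add_left_mono mult_right_mono) auto
    also have "\<dots> = 3 * ((1 - \<epsilon>) * N + \<epsilon> * n) * S\<^sup>2 / 6" by (simp add: field_simps)
    finally have "6 * T \<le> 3 * ((1 - \<epsilon>) * N + \<epsilon> * n) * S\<^sup>2" using T by linarith
    moreover have "0 \<le> (\<Sum>u\<in>V. \<Sum>v\<in>V. \<Sum>w\<in>V. adj E u v * (1 - adj E u w) * (1 - adj E v w))"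
      by (intro sum_nonneg) (auto simp: adj_def)
    ultimately have "8 * (N * S)\<^sup>2 / n - 2 * (N * S) * n - 3 * ((1 - \<epsilon>) * N + \<epsilon> * n) * S\<^sup>2 \<le> 0"
      using lower[of 0] by linarith
    also have "8 * (N * S)\<^sup>2 / n - 2 * (N * S) * n - 3 * ((1 - \<epsilon>) * N + \<epsilon> * n) * S\<^sup>2
        = 3 * n * S\<^sup>2 * (8 / 3 * x\<^sup>2 - (2 / (3 * u) + (1 - \<epsilon>)) * x + - \<epsilon>)"
      using n S by (simp add: x_def u_def field_simps power2_eq_square)
    finally have "\<not> 0 < 8 / 3 * x\<^sup>2 - (2 / (3 * u) + (1 - \<epsilon>)) * x + - \<epsilon>"
      using n S by (auto simp: mult_le_0_iff)
    moreover have "0 < 8 / 3 * x\<^sup>2 - (2 / (3 * u) + (1 - \<epsilon>)) * x + - \<epsilon>"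
      by (rule quadratic_pos_mono[of y t]) (use c1 c3 eps y(1) x t(1) u in auto)
    ultimately show False by blast
  qed

  have "\<exists>v. (1 + lam) * S / 2 \<le> real (card (star (F i) v))" if "i \<in> G" for i
  proof -
    have i: "i \<in> I" using that GI by auto
    have "\<tau> i \<le> real (card (wedge_triples (F i)))"
      unfolding \<tau>_def using i by (intro of_nat_mono card_mono finite_wedge_triples F2 Ff) auto
    then have "(1 - \<epsilon>) * S\<^sup>2 / 2 \<le> real (card (wedge_triples (F i)))" using that by (simp add: G_def)
    moreover have "S = real (card (F i))" using Fs[OF i] by (simp add: S_def)
    ultimately obtain v where "(1 + lam) * S / 2 \<le> real (card (star (F i) v))"
      using exists_large_star[OF F2[OF i] Ff[OF i] _ S eps(2) lam] by blast
    then show ?thesis ..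
  qed
  then have "\<forall>i\<in>G. \<exists>v. (1 + lam) * S / 2 \<le> real (card (star (F i) v))" by blast
  from bchoice[OF this] obtain center
    where center: "\<And>i. i \<in> G \<Longrightarrow> (1 + lam) * S / 2 \<le> real (card (star (F i) (center i)))" by blast
  \<comment> \<open>Centres are vertices because their stars are nonempty; as \<open>G\<close> has
    more elements than \<open>V\<close>, two colours share a centre.\<close>
  have "center ` G \<subseteq> V"
  proof clarify
    fix i assume i: "i \<in> G"
    have "0 < (1 + lam) * S / 2" using S lam01 by simp
    then have "star (F i) (center i) \<noteq> {}" using center[OF i] by auto
    then show "center i \<in> V" using FV[of i] i GI by (auto simp: star_def nsets_def)
  qed
  then have "card (center ` G) < card G"
    using \<open>card V < card G\<close> card_mono[OF V(1)] by (meson le_less_trans)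
  then have "\<not> inj_on center G" by (rule pigeonhole)
  then obtain i j where ij: "i \<in> G" "j \<in> G" "i \<noteq> j" and cij: "center j = center i"
    unfolding inj_on_def by metis
  have iI: "i \<in> I" and jI: "j \<in> I" using ij GI by auto
  define v where "v = center i"
  define A where "A = nbhd (F i) v"
  define B where "B = nbhd (F j) v"
  define a where "a = real (card A)"
  define b where "b = real (card B)"
  define eA where "eA = real (card (E \<inter> nsets A 2))"
  define eB where "eB = real (card (E \<inter> nsets B 2))"
  have AV: "A \<subseteq> V" "B \<subseteq> V" using FV[OF iI] FV[OF jI] by (auto simp: A_def B_def nbhd_def nsets_def)
  have AB: "A \<inter> B = {}" using disj[OF iI jI ij(3)] by (auto simp: A_def B_def nbhd_def)
  have a: "(1 + lam) * S / 2 \<le> a" and b: "(1 + lam) * S / 2 \<le> b"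
    using center[OF ij(1)] center[OF ij(2)] card_nbhd[OF F2[OF iI]] card_nbhd[OF F2[OF jI]] cij
    by (auto simp: a_def b_def A_def B_def v_def)
  have qa: "real (card (F i - star (F i) v)) = S - a"
    using card_Diff_star[OF Ff[OF iI], of v] card_nbhd[OF F2[OF iI], of v] Fs[OF iI]
    by (simp add: S_def a_def A_def)
  have qb: "real (card (F j - star (F j) v)) = S - b"
    using card_Diff_star[OF Ff[OF jI], of v] card_nbhd[OF F2[OF jI], of v] Fs[OF jI]
    by (simp add: S_def b_def B_def)
  have qnn: "0 \<le> S - a" "0 \<le> S - b" unfolding qa[symmetric] qb[symmetric] by simp_all
  have eA: "(1 - \<epsilon>) * S\<^sup>2 / 2 - ((S - a)\<^sup>2 + (S - a)) / 2 \<le> eA"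
    unfolding eA_def A_def
    by (rule card_edges_nbhd_ge[OF F2[OF iI] Ff[OF iI] _ qa[symmetric]]) (use ij in \<open>simp add: G_def \<tau>_def\<close>)
  have eB: "(1 - \<epsilon>) * S\<^sup>2 / 2 - ((S - b)\<^sup>2 + (S - b)) / 2 \<le> eB"
    unfolding eB_def B_def
    by (rule card_edges_nbhd_ge[OF F2[OF jI] Ff[OF jI] _ qb[symmetric]]) (use ij in \<open>simp add: G_def \<tau>_def\<close>)
  \<comment> \<open>A cross edge \<open>{p, q}\<close> closes a triangle whose sides at
    \<open>v\<close> have colours \<open>i\<close> and \<open>j\<close>, so it has one of these
    colours itself. Missing \<open>v\<close>, it lies off the corresponding star.\<close>
  have cross: "(\<Sum>u\<in>A. \<Sum>w\<in>B. adj E u w) \<le> (S - a) + (S - b)"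
  proof -
    let ?S = "(F i - star (F i) v) \<union> (F j - star (F j) v)"
    have "(\<Sum>u\<in>A. \<Sum>w\<in>B. adj E u w) \<le> real (card ?S)"
    proof (rule sum_adj_cross_le[OF _ _ _ AB])
      fix p q assume p: "p \<in> A" and q: "q \<in> B" and pq: "{p, q} \<in> E"
      have pi: "{v, p} \<in> F i" "p \<noteq> v" and qj: "{v, q} \<in> F j" "q \<noteq> v"
        using p q by (auto simp: A_def B_def nbhd_def)
      have "p \<noteq> q" using p q AB by auto
      have "e \<in> E" if "e \<in> nsets {v, p, q} 2" for e
      proof -
        from that obtain c d where "e = {c, d}" "c \<noteq> d" "c \<in> {v, p, q}" "d \<in> {v, p, q}"
          by (auto simp: nsets_def card_2_iff)
        moreover have "{v, p} \<in> E" "{v, q} \<in> E" using pi qj iI jI by (auto simp: E_def)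
        ultimately show ?thesis using pq by (auto simp: insert_commute)
      qed
      then have "{v, p, q} \<in> triangles E" using pi qj \<open>p \<noteq> q\<close> by (auto simp: triangles_def)
      then obtain k where k: "k \<in> I" "{v, p, q} \<in> wedge_triples (F k)" using tri by auto
      have "k = i" if "{v, p} \<in> F k" using disj[OF k(1) iI] that pi by auto
      moreover have "k = j" if "{v, q} \<in> F k" using disj[OF k(1) jI] that qj by auto
      ultimately have "{p, q} \<in> F i \<or> {p, q} \<in> F j"
        using triangle_mem_wedge_triples[OF F2[OF k(1)] k(2)] ij(3) by metis
      then show "{p, q} \<in> ?S" using pi qj by (auto simp: star_def)
    qed (use AV V Ff[OF iI] Ff[OF jI] finite_subset in auto)
    also have "card ?S \<le> card (F i - star (F i) v) + card (F j - star (F j) v)"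
      by (rule card_Un_le)
    finally show ?thesis using qa qb by simp
  qed
  define c where "c = (S - a) + (S - b)"
  \<comment> \<open>The main term of \<open>eA\<close> and \<open>eB\<close>:
    \<open>(1 - \<epsilon>) * S\<^sup>2 / 2\<close> minus half the square of
    \<open>(1 - lam) * S / 2\<close>, the largest possible number of edges off the star.\<close>
  define K where "K = (4 * (1 - \<epsilon>) - (1 - lam)\<^sup>2) / 8 * S\<^sup>2"
  have K: "0 \<le> K"
  proof -
    have "(1 - lam)\<^sup>2 \<le> 1" using lam01 by (simp add: power_le_one)
    then show ?thesis using eps by (simp add: K_def)
  qed
  \<comment> \<open>Edges \<open>e\<close> among the leaves of one star are paired with the
    \<open>d'\<close> leaves of the other. The linear loss \<open>(S - d) / 2\<close> in
    \<open>e\<close> costs \<open>(S - d) * d' \<le> S\<^sup>2 / 2\<close>.\<close>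
  have block: "(1 + lam) * S * K - S\<^sup>2 / 2 \<le> 2 * e * d'"
    if e: "(1 - \<epsilon>) * S\<^sup>2 / 2 - ((S - d)\<^sup>2 + (S - d)) / 2 \<le> e"
      and d: "(1 + lam) * S / 2 \<le> d" "0 \<le> S - d" and d': "(1 + lam) * S / 2 \<le> d'" "0 \<le> S - d'" for e d d'
  proof -
    have lS: "0 \<le> lam * S" using lam01 S by simp
    have q: "S - d \<le> (1 - lam) * S / 2" using d by (simp add: field_simps)
    then have "(S - d)\<^sup>2 \<le> ((1 - lam) * S / 2)\<^sup>2" using d by (intro power_mono) auto
    then have h: "K - (S - d) / 2 \<le> e" using e
      by (simp add: K_def field_simps power2_eq_square)
    have d'0: "0 \<le> d'" using d' S lS by (simp add: algebra_simps)
    have "(K - (S - d) / 2) * d' \<le> e * d'" using h d'0 by (rule mult_right_mono)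
    moreover have "(K - (S - d) / 2) * d' = d' * K - (S - d) * d' / 2" by (simp add: field_simps)
    moreover have "(1 + lam) * S * K / 2 \<le> d' * K" using mult_right_mono[OF d'(1) K] by simp
    moreover have "(S - d) * d' \<le> S\<^sup>2 / 2"
    proof -
      have "S - d \<le> S / 2" "d' \<le> S" using q d'(2) lS by (auto simp: field_simps)
      then have "(S - d) * d' \<le> (S / 2) * S" using d(2) d'0 S by (intro mult_mono) auto
      then show ?thesis by (simp add: power2_eq_square)
    qed
    ultimately show ?thesis by linarith
  qed
  have "2 * eA * b + 2 * eB * a - 2 * (a + b) * c
      \<le> (\<Sum>u\<in>V. \<Sum>v\<in>V. \<Sum>w\<in>V. adj E u v * (1 - adj E u w) * (1 - adj E v w))"
    using sum_single_edge_triples_ge[OF V(1) AV AB E2 cross]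
    by (simp add: a_def b_def c_def eA_def eB_def)
  note lower[OF this]
  moreover have "6 * T \<le> 3 * N * S * (S - 1)"
  proof -
    have "(\<Sum>i\<in>I. \<tau> i) \<le> N * (S * (S - 1) / 2)"
      unfolding N_def using \<tau> by (rule sum_bounded_above)
    then show ?thesis using T by simp
  qed
  moreover have "2 * (a + b) * c \<le> 4 * S\<^sup>2"
  proof -
    have "0 \<le> lam * S" using lam01 S by simp
    then have "a + b \<le> 2 * S" "c \<le> S" "0 \<le> c" using qnn a b by (auto simp: c_def field_simps)
    then have "(a + b) * c \<le> (2 * S) * S" using S by (intro mult_mono) auto
    then show ?thesis by (simp add: power2_eq_square algebra_simps)
  qed
  moreover have "(1 + lam) * S * K - S\<^sup>2 / 2 \<le> 2 * eA * b" by (rule block[OF eA a qnn(1) b qnn(2)])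
  moreover have "(1 + lam) * S * K - S\<^sup>2 / 2 \<le> 2 * eB * a" by (rule block[OF eB b qnn(2) a qnn(1)])
  moreover have "3 * N * S * (S - 1) = 3 * N * S\<^sup>2 - 3 * N * S"
    by (simp add: power2_eq_square algebra_simps)
  \<comment> \<open>The errors are \<open>S\<^sup>2 / 2\<close> from each block and
    \<open>4 * S\<^sup>2\<close> from cross edges. The slack \<open>3 * N * S\<close> left by
    \<open>S * (S - 1) / 2\<close> absorbs them because \<open>2 * S < n < N\<close>.\<close>
  moreover have "5 * S\<^sup>2 \<le> 3 * N * S"
    using Sn nN S by (simp add: power2_eq_square)
  ultimately have "8 * (N * S)\<^sup>2 / n - 2 * (N * S) * n + 2 * ((1 + lam) * S * K) - 3 * N * S\<^sup>2 \<le> 0"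
    by linarith
  moreover define C where "C = (lam + 1) * (4 * (1 - \<epsilon>) - (1 - lam)\<^sup>2)"
  have "2 * ((1 + lam) * S * K) = S * S * S * C / 4"
    by (simp add: K_def C_def power2_eq_square)
  ultimately have "8 * (N * S)\<^sup>2 / n - 2 * (N * S) * n + S * S * S * C / 4 - 3 * N * S\<^sup>2 \<le> 0"
    by linarith
  also have "8 * (N * S)\<^sup>2 / n - 2 * (N * S) * n + S * S * S * C / 4 - 3 * N * S\<^sup>2
      = 3 * n * S\<^sup>2 * (8 / 3 * x\<^sup>2 - (2 / (3 * u) + 1) * x + u / 12 * C)"
    using n S by (simp add: x_def u_def field_simps power2_eq_square)
  finally have "3 * n * S\<^sup>2 * (8 / 3 * x\<^sup>2 - (2 / (3 * u) + 1) * x + u / 12 * C) \<le> 0" .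
  moreover have "0 < 8 / 3 * x\<^sup>2 - (2 / (3 * u) + 1) * x + u / 12 * C"
  proof (rule quadratic_pos_mono)
    \<comment> \<open>The constant term also contains the class size; nonnegativity of
      \<open>C\<close> lets \<open>t\<close> be raised to \<open>u\<close> there before monotonicity
      is applied.\<close>
    have "0 \<le> C" using K S lam01 by (simp add: C_def K_def zero_le_mult_iff)
    then have "t / 12 * C \<le> u / 12 * C" using u by (intro mult_right_mono) auto
    moreover have "t / 12 * (lam + 1) * (4 * (1 - \<epsilon>) - (1 - lam)\<^sup>2) = t / 12 * C"
      by (simp add: C_def)
    ultimately show "0 < 8 / 3 * y\<^sup>2 - (2 / (3 * t) + 1) * y + u / 12 * C"
      using c2 by linarith
  qed (use c3 y x t u in auto)
  moreover have "0 < 3 * n * S\<^sup>2" using n S by simp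
  ultimately show False using mult_pos_pos by (metis not_less)
qed

section \<open>Reduction to trimmed colour classes\<close>

theorem theorem3p1:
  fixes t \<delta> :: real
    and V :: "'a set" and E :: "'a set set" and f :: "'a set \<Rightarrow> nat" and n :: nat
  assumes "t > 0" and "\<delta> > 0"
    and "\<exists>\<epsilon> lam :: real. 0 < \<epsilon> \<and> \<epsilon> < 1 / 2 \<and> lam = sqrt (1 - 2 * \<epsilon>) \<and>
      (1 + \<delta> - \<epsilon> * \<delta>) * t / 2 < 4 / 3 * (1 + \<delta>) * (t * (1 + \<delta>) - 1 / 4) \<and>
      8 / (3 * t) * (t * (1 + \<delta>) - 1 / 4) * (1 + \<delta>)
        + t / 12 * (lam + 1) * (4 * (1 - \<epsilon>) - (1 - lam)\<^sup>2) > 1 + \<delta> \<and>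
      16 / 3 * (1 + \<delta>) > 2 / (3 * t) + 1"
    and "simple_graph V E" and "card V = n"
    and "real (card {i. color_class E f i \<noteq> {} \<and> real (card (color_class E f i)) \<ge> t * real n})
      \<ge> (1 + \<delta>) * real n"
  shows "has_rainbow_triangle E f"
proof (rule ccontr)
  assume norb: "\<not> has_rainbow_triangle E f"
  obtain \<epsilon> lam where eps: "0 < \<epsilon>" "\<epsilon> < 1 / 2" and lam: "lam = sqrt (1 - 2 * \<epsilon>)"
    and h1: "(1 + \<delta> - \<epsilon> * \<delta>) * t / 2 < 4 / 3 * (1 + \<delta>) * (t * (1 + \<delta>) - 1 / 4)"
    and h2: "8 / (3 * t) * (t * (1 + \<delta>) - 1 / 4) * (1 + \<delta>)
        + t / 12 * (lam + 1) * (4 * (1 - \<epsilon>) - (1 - lam)\<^sup>2) > 1 + \<delta>"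
    and h3: "16 / 3 * (1 + \<delta>) > 2 / (3 * t) + 1"
    using assms(3) by blast
  define y where "y = 1 + \<delta>"
  have V: "finite V" "V \<noteq> {}" and EV: "E \<subseteq> nsets V 2" using assms(4) by (auto simp: simple_graph_def)
  have n: "n > 0" using V assms(5) by (simp add: card_gt_0_iff flip: assms(5))
  define I where "I = {i. color_class E f i \<noteq> {} \<and> real (card (color_class E f i)) \<ge> t * real n}"
  have cI: "y * real n \<le> real (card I)" using assms(6) by (simp add: I_def y_def)
  \<comment> \<open>Positivity matters because an infinite set has \<open>card\<close> zero; it
    yields finiteness of \<open>I\<close>.\<close>
  have "0 < y * real n" using n assms(2) by (simp add: y_def)
  then have "0 < card I" using cI by linarith
  then have I: "finite I" by (rule card_ge_0_finite)
  \<comment> \<open>Class sizes are integers, so each class in \<open>I\<close> has at least this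
    many edges, and the trimmed size is still at least \<open>t * n\<close>.\<close>
  define s where "s = nat \<lceil>t * real n\<rceil>"
  have "\<exists>F. F \<subseteq> color_class E f i \<and> card F = s" if "i \<in> I" for i
  proof -
    have "s \<le> card (color_class E f i)" using that by (simp add: s_def I_def ceiling_le_iff)
    then show ?thesis by (metis obtain_subset_with_card_n)
  qed
  then obtain F where F: "\<And>i. i \<in> I \<Longrightarrow> F i \<subseteq> color_class E f i" "\<And>i. i \<in> I \<Longrightarrow> card (F i) = s"
    by metis
  have FE: "e \<in> E \<and> f e = i" if "i \<in> I" "e \<in> F i" for i e
    using F(1) that by (auto simp: color_class_def)
  show False
  proof (rule no_uniform_rainbow_free_family[where I = I and F = F and s = s and y = y and t = t and V = V,
        OF V I _ F(2) _ _ assms(1) _ _ _ eps lam])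
    show "F i \<subseteq> nsets V 2" if "i \<in> I" for i using FE[OF that] EV by auto
    show "F i \<inter> F j = {}" if "i \<in> I" "j \<in> I" "i \<noteq> j" for i j using FE that by blast
    show "t * real (card V) \<le> real s" unfolding assms(5) s_def by linarith
    show "1 < y" using assms(2) by (simp add: y_def)
    show "y * real (card V) \<le> real (card I)" using cI assms(5) by simp
    show "16 / 3 * y > 2 / (3 * t) + 1" using h3 by (simp add: y_def)
    \<comment> \<open>The first hypothesis as a positive difference, scaled by \<open>2 / t\<close>
      to the normalised quadratic.\<close>
    have "0 < (4 / 3 * y * (t * y - 1 / 4) - (y - \<epsilon> * (y - 1)) * t / 2) * (2 / t)"
      using h1 assms(1) by (intro mult_pos_pos) (auto simp: y_def)
    also have "\<dots> = 8 / 3 * y\<^sup>2 - (2 / (3 * t) + (1 - \<epsilon>)) * y - \<epsilon>"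
      using assms(1) by (simp add: field_simps power2_eq_square)
    finally show "0 < 8 / 3 * y\<^sup>2 - (2 / (3 * t) + (1 - \<epsilon>)) * y - \<epsilon>" .
    have "8 / (3 * t) * (t * y - 1 / 4) * y = 8 / 3 * y\<^sup>2 - 2 / (3 * t) * y"
      using assms(1) by (simp add: field_simps power2_eq_square)
    then show "0 < 8 / 3 * y\<^sup>2 - (2 / (3 * t) + 1) * y + t / 12 * (lam + 1) * (4 * (1 - \<epsilon>) - (1 - lam)\<^sup>2)"
      using h2 unfolding y_def[symmetric] distrib_right by linarith
    show "triangles (\<Union>i\<in>I. F i) \<subseteq> (\<Union>i\<in>I. wedge_triples (F i))"
    proof
      fix X assume X: "X \<in> triangles (\<Union>i\<in>I. F i)"
      then have X3: "card X = 3" and sub: "nsets X 2 \<subseteq> (\<Union>i\<in>I. F i)" by (auto simp: triangles_def)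
      obtain p q r where pqr: "X = {p, q, r}" "p \<noteq> q" "q \<noteq> r" "p \<noteq> r"
        using X3 by (auto simp: card_3_iff)
      have col: "\<exists>i\<in>I. e \<in> F i \<and> f e = i \<and> e \<in> E" if "e \<in> nsets X 2" for e
        using sub that FE by blast
      have "{p, q} \<in> nsets X 2" "{q, r} \<in> nsets X 2" "{p, r} \<in> nsets X 2"
        using pqr by (auto simp: nsets_def)
      note c = this[THEN col]
      \<comment> \<open>An edge of \<open>X\<close> lies in the trimmed class indexed by its own
        colour, so two edges of equal colour lie in the same class.\<close>
      have mem: "X \<in> (\<Union>i\<in>I. wedge_triples (F i))"
        if "\<exists>i\<in>I. e \<in> F i \<and> f e = i \<and> e \<in> E" "\<exists>i\<in>I. e' \<in> F i \<and> f e' = i \<and> e' \<in> E"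
          "f e = f e'" "e \<noteq> e'" "e \<subseteq> X" "e' \<subseteq> X" for e e'
      proof -
        have "f e \<in> I" "e \<in> F (f e)" "e' \<in> F (f e)" using that(1-3) by auto
        then show ?thesis using that(4-6) X3 unfolding wedge_triples_def by blast
      qed
      consider "f {p, q} = f {q, r}" | "f {q, r} = f {p, r}" | "f {p, q} = f {p, r}"
      proof -
        have "{p, q} \<in> E" "{q, r} \<in> E" "{p, r} \<in> E" using c by blast+
        then show thesis using that norb pqr(2-4) unfolding has_rainbow_triangle_def by metis
      qed
      then show "X \<in> (\<Union>i\<in>I. wedge_triples (F i))"
      proof cases
        case 1 show ?thesis by (rule mem[OF c(1,2) 1]) (use pqr in auto)
      next
        case 2 show ?thesis by (rule mem[OF c(2,3) 2]) (use pqr in auto)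
      next
        case 3 show ?thesis by (rule mem[OF c(1,3) 3]) (use pqr in auto)
      qed
    qed
  qed
qed

end
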